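(* For every integer $m\ge 6$, $$\frac{2m}{9}\le \frac12 m^2-F(m)\le 2m-3.$$ Consequently, $F(m)=\frac12 m^2-\Theta(m)$ as $m\to\infty$, and $$\lim_{m\to\infty}\frac{F(m)}{m^2}=\frac12.$$
   Context: For an integer $m\ge 2$, the grid is $G_m=\{1,\dots,m\}\times\{1,\dots,m\}$; its elements are called squares, and $(i,j)$ is the square in row $i$ and column $j$. For integers $1\le a,b\le m-1$, the card $C_{a,b}$ is the set $\{(a,b),(a+1,b),(a,b+1),(a+1,b+1)\}$, and $\mathcal C_m=\{C_{a,b}:1\le a,b\le m-1\}$. A configuration is a non-empty subset $U\subseteq\mathcal C_m$. The multiplicity of $x\in G_m$ is $\mu(x)=|\{C\in U: x\in C\}|$. A square $x$ is private for $C\in U$ if $x\in C$ and $\mu(x)=1$. $U$ is an irredundant cover of $G_m$ if $\mu(x)\ge 1$ for every $x\in G_m$ and every $C\in U$ contains at least one private square. $F(m)=\max\{|U|: U\subseteq\mathcal C_m\text{ is an irredundant cover of }G_m\}$. The notation $F(m)=\frac12 m^2-\Theta(m)$ means that there are constants $c,c'>0$ with $cm\le\frac12 m^2-F(m)\le c'm$ for all sufficiently large $m$. *)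

theory Defs
  imports Complex_Main
begin

type_synonym square = "nat \<times> nat"

definition grid :: "nat \<Rightarrow> square set" where
  "grid m = {1..m} \<times> {1..m}"

(* The "cards" are the 2 x 2 blocks; the name block avoids confusion with the cardinality card. *)
definition block :: "nat \<Rightarrow> nat \<Rightarrow> square set" where
  "block a b = {(a, b), (a + 1, b), (a, b + 1), (a + 1, b + 1)}"

definition blocks :: "nat \<Rightarrow> square set set" where
  "blocks m = {block a b | a b. 1 \<le> a \<and> a \<le> m - 1 \<and> 1 \<le> b \<and> b \<le> m - 1}"

definition configuration :: "nat \<Rightarrow> square set set \<Rightarrow> bool" where
  "configuration m U \<longleftrightarrow> U \<noteq> {} \<and> U \<subseteq> blocks m"

definition square_mult :: "square set set \<Rightarrow> square \<Rightarrow> nat" where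
  "square_mult U x = card {C \<in> U. x \<in> C}"

definition private_square :: "square set set \<Rightarrow> square set \<Rightarrow> square \<Rightarrow> bool" where
  "private_square U C x \<longleftrightarrow> x \<in> C \<and> square_mult U x = 1"

definition irredundant_cover :: "nat \<Rightarrow> square set set \<Rightarrow> bool" where
  "irredundant_cover m U \<longleftrightarrow>
     configuration m U \<and>
     (\<forall>x\<in>grid m. square_mult U x \<ge> 1) \<and>
     (\<forall>C\<in>U. \<exists>x. private_square U C x)"

(* F(m). Max is meaningful only for m >= 2, where the set is finite and non-empty;
   for m < 2 there are no configurations and the value is unspecified. *)
definition max_irredundant :: "nat \<Rightarrow> nat" where
  "max_irredundant m = Max {card U | U. irredundant_cover m U}"

end

theory Submission
  imports Defs
begin

text \<open>
Describe an irredundant cover by the set \<open>A\<close> of its positions, where the block at position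
\<open>(a, b)\<close> has its smallest square there; with \<open>n = m - 1\<close> this is a subset of an
\<open>n\<close> by \<open>n\<close> board. A private square of a block is a window of two by two positions
that meets \<open>A\<close> only once, so each member of \<open>A\<close> has a vertical neighbour, a horizontal
neighbour and the diagonal neighbour between them that are all empty.

Upper bound. Let each member of \<open>A\<close> charge one such vertical and one such horizontal empty
neighbour. An empty position on the board is charged at most twice: a vertical charge comes
with an empty horizontal neighbour of the charged position, and conversely, so charges of
both kinds use only two of the four neighbours. A position just outside the board is charged
only by the member of \<open>A\<close> next to it, and a border line contains no three consecutive
members of \<open>A\<close>, because the middle one would have no empty neighbour along the line.
Counting the charges gives
\<open>2 |A| \<le> 2 (n^2 - |A|) + 4 (n - n div 3)\<close>,
and the term \<open>n div 3\<close> is the linear gain (\<open>card_free_corner_le\<close>).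

Lower bound. Let \<open>S\<close> be a set of squares such that the blocks containing at most one
square of \<open>S\<close> still cover the grid. A minimal subfamily of these blocks that still covers is
irredundant, and it needs a separate block for each square of \<open>S\<close>
(\<open>irredundant_cover_of_spread_set\<close>). Take for \<open>S\<close> the inner squares
on the diagonals \<open>i + j \<equiv> 1, 2 (mod 4)\<close>, together with one or two corners. These
diagonals contain half of the inner squares, up to a bounded error, which gives
\<open>|S| \<ge> m^2 / 2 - 2 m + 3\<close>.
\<close>

section \<open>Blocks and their positions\<close>

lemma block_inject [simp]: "block a b = block c d \<longleftrightarrow> a = c \<and> b = d"
proof
  assume eq: "block a b = block c d"
  have "(a, b) \<in> block c d" "(a + 1, b + 1) \<in> block c d"
    unfolding eq[symmetric] by (auto simp: block_def)
  then show "a = c \<and> b = d"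
    by (auto simp: block_def)
qed auto

definition positions :: "square set set \<Rightarrow> (nat \<times> nat) set" where
  "positions U = {(a, b). block a b \<in> U}"

lemma finite_blocks: "finite (blocks m)"
proof (rule finite_subset)
  show "blocks m \<subseteq> (\<lambda>(a, b). block a b) ` ({1..m - 1} \<times> {1..m - 1})"
    by (force simp: blocks_def)
qed simp

lemma positions_subset:
  assumes "U \<subseteq> blocks m"
  shows "positions U \<subseteq> {1..m - 1} \<times> {1..m - 1}"
  using assms by (auto simp: positions_def blocks_def)

lemma card_positions:
  assumes "U \<subseteq> blocks m"
  shows "card (positions U) = card U"
proof -
  have "(\<lambda>(a, b). block a b) ` positions U = U"
    using assms by (auto simp: positions_def blocks_def image_iff)
  moreover have "inj_on (\<lambda>(a, b). block a b) (positions U)"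
    by (auto simp: inj_on_def)
  ultimately show ?thesis
    by (metis card_image)
qed

lemma private_square_unique:
  assumes "private_square U C x" "C \<in> U" "D \<in> U" "x \<in> D"
  shows "D = C"
proof -
  have "card {E \<in> U. x \<in> E} = 1" and "x \<in> C"
    using assms(1) by (simp_all add: private_square_def square_mult_def)
  from this(1) obtain E where "{E \<in> U. x \<in> E} = {E}"
    by (rule card_1_singletonE)
  moreover have "C \<in> {E \<in> U. x \<in> E}" "D \<in> {E \<in> U. x \<in> E}"
    using assms(2-4) \<open>x \<in> C\<close> by simp_all
  ultimately show ?thesis by simp
qed

section \<open>The upper bound\<close>

text \<open>
The private square lies in exactly four blocks of the infinite grid, and their positions
form a two by two window with \<open>(a, b)\<close> in one corner; the three others are the free ones.
As \<open>a\<close> and \<open>b\<close> are positive, the subtractions do not truncate.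
\<close>

lemma private_square_free_corner:
  assumes C: "block a b \<in> U" and priv: "private_square U (block a b) x"
    and pos: "a \<ge> 1" "b \<ge> 1"
  shows "\<exists>c d. (c = a - 1 \<or> c = a + 1) \<and> (d = b - 1 \<or> d = b + 1) \<and>
           (c, b) \<notin> positions U \<and> (a, d) \<notin> positions U \<and> (c, d) \<notin> positions U"
proof -
  obtain i j where x: "x = (i, j)" by fastforce
  have ij: "i = a \<or> i = a + 1" "j = b \<or> j = b + 1"
    using priv x by (auto simp: private_square_def block_def)
  have uniq: "block c d \<in> U \<Longrightarrow> (i, j) \<in> block c d \<Longrightarrow> c = a \<and> d = b" for c d
    using private_square_unique[OF priv C] x by (metis block_inject)
  define c where "c = (if i = a then a - 1 else a + 1)"
  define d where "d = (if j = b then b - 1 else b + 1)"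
  have "(i, j) \<in> block c b" "(i, j) \<in> block a d" "(i, j) \<in> block c d"
    using ij pos by (auto simp: block_def c_def d_def)
  moreover have "c \<noteq> a" "d \<noteq> b"
    using pos by (auto simp: c_def d_def)
  ultimately have "(c, b) \<notin> positions U \<and> (a, d) \<notin> positions U \<and> (c, d) \<notin> positions U"
    using uniq by (auto simp: positions_def)
  moreover have "c = a - 1 \<or> c = a + 1" "d = b - 1 \<or> d = b + 1"
    by (simp_all add: c_def d_def)
  ultimately show ?thesis by blast
qed

text \<open>
Each of the \<open>n div 3\<close> disjoint triples of consecutive numbers has an element outside \<open>L\<close>.
\<close>

lemma card_no_three_consecutive:
  fixes n :: nat
  assumes "L \<subseteq> {1..n}" and "\<And>b. \<lbrakk>b \<in> L; b + 1 \<in> L; b + 2 \<in> L\<rbrakk> \<Longrightarrow> False"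
  shows "card L + n div 3 \<le> n"
  using assms
proof (induction n arbitrary: L rule: less_induct)
  case (less n)
  show ?case
  proof (cases "n < 3")
    case True
    then show ?thesis
      using card_mono[OF _ less.prems(1)] by simp
  next
    case False
    define k where "k = n - 3"
    have n: "n = k + 3" using False by (simp add: k_def)
    have "card (L \<inter> {1..k}) + k div 3 \<le> k"
    proof (rule less.IH)
      show "k < n" by (simp add: n)
      show "L \<inter> {1..k} \<subseteq> {1..k}" by blast
      show False if "b \<in> L \<inter> {1..k}" "b + 1 \<in> L \<inter> {1..k}" "b + 2 \<in> L \<inter> {1..k}" for b
        using less.prems(2)[of b] that by blast
    qed
    moreover have "card (L \<inter> {k + 1, k + 2, k + 3}) \<le> 2"
    proof -
      have "L \<inter> {k + 1, k + 2, k + 3} \<noteq> {k + 1, k + 2, k + 3}"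
      proof
        assume "L \<inter> {k + 1, k + 2, k + 3} = {k + 1, k + 2, k + 3}"
        then have "k + 1 \<in> L" "k + 2 \<in> L" "k + 3 \<in> L" by blast+
        then show False using less.prems(2)[of "k + 1"] by (simp add: numeral_eq_Suc)
      qed
      then have "L \<inter> {k + 1, k + 2, k + 3} \<subset> {k + 1, k + 2, k + 3}" by blast
      from psubset_card_mono[OF _ this] show ?thesis by simp
    qed
    moreover have "(L \<inter> {1..k}) \<union> (L \<inter> {k + 1, k + 2, k + 3}) = L"
      using less.prems(1) by (auto simp: n)
    then have "card L \<le> card (L \<inter> {1..k}) + card (L \<inter> {k + 1, k + 2, k + 3})"
      using card_Un_le[of "L \<inter> {1..k}" "L \<inter> {k + 1, k + 2, k + 3}"] by (simp only:)
    ultimately show ?thesis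
      by (simp add: n)
  qed
qed

lemma card_fibres_le:
  assumes "finite X" "\<And>e. e \<in> E \<Longrightarrow> z e \<in> X"
    and "\<And>x. x \<in> X \<Longrightarrow> card {e \<in> E. z e = x} \<le> k"
  shows "card E \<le> k * card X"
proof -
  have "(\<Union>x\<in>X. {e \<in> E. z e = x}) = E" using assms(2) by auto
  then have "card E \<le> (\<Sum>x\<in>X. card {e \<in> E. z e = x})"
    using card_UN_le[OF assms(1), of "\<lambda>x. {e \<in> E. z e = x}"] by (simp only:)
  also have "\<dots> \<le> (\<Sum>x\<in>X. k)" using assms(3) by (rule sum_mono)
  finally show ?thesis by (simp add: mult.commute)
qed

text \<open>
The double count behind the upper bound. A pair \<open>(p, v)\<close> in \<open>E\<close> is the vertical
(\<open>v = True\<close>) or horizontal (\<open>v = False\<close>) charge made by \<open>p\<close>, and \<open>z\<close> is the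
position charged. \<open>Ein\<close> collects the charges to the set \<open>X\<close> of empty positions on the
board, \<open>Eout\<close> those to positions just outside. Halving the resulting inequality
\<open>4 |A| + 4 (n div 3) \<le> 2 n^2 + 4 n\<close> gives the claim.
\<close>

lemma card_free_corner_le:
  fixes A :: "(nat \<times> nat) set"
  assumes A: "A \<subseteq> {1..n} \<times> {1..n}"
    and corner: "\<And>a b. (a, b) \<in> A \<Longrightarrow> \<exists>c d. (c = a - 1 \<or> c = a + 1) \<and> (d = b - 1 \<or> d = b + 1) \<and>
           (c, b) \<notin> A \<and> (a, d) \<notin> A \<and> (c, d) \<notin> A"
  shows "2 * card A + 2 * (n div 3) \<le> n\<^sup>2 + 2 * n"
proof -
  have finA: "finite A" using A by (rule finite_subset) simp
  from corner have "\<forall>p\<in>A. \<exists>c d. (c = fst p - 1 \<or> c = fst p + 1) \<and> (d = snd p - 1 \<or> d = snd p + 1) \<and>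
           (c, snd p) \<notin> A \<and> (fst p, d) \<notin> A \<and> (c, d) \<notin> A"
    by auto
  then obtain f g where fg: "\<And>p. p \<in> A \<Longrightarrow> (f p = fst p - 1 \<or> f p = fst p + 1) \<and>
           (g p = snd p - 1 \<or> g p = snd p + 1) \<and>
           (f p, snd p) \<notin> A \<and> (fst p, g p) \<notin> A \<and> (f p, g p) \<notin> A"
    by metis
  define z where "z = (\<lambda>(p, v). if v then (f p, snd p) else (fst p, g p))"
  define E where "E = A \<times> (UNIV :: bool set)"
  define X where "X = {1..n} \<times> {1..n} - A"
  define Ein where "Ein = {e \<in> E. z e \<in> X}"
  define Eout where "Eout = {e \<in> E. z e \<notin> X}"
  have cardE: "card E = 2 * card A" by (simp add: E_def card_cartesian_product)
  have cardX: "card X + card A = n\<^sup>2"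
    using card_Diff_subset[OF finA A] card_mono[OF _ A]
    by (simp add: X_def card_cartesian_product power2_eq_square)
  have "card Ein \<le> 2 * card X"
  proof (rule card_fibres_le[where z = z])
    show "finite X" by (simp add: X_def)
    show "z e \<in> X" if "e \<in> Ein" for e using that by (simp add: Ein_def)
    fix x assume "x \<in> X"
    then obtain i j where x: "x = (i, j)" and ij: "i \<ge> 1" "j \<ge> 1" by (auto simp: X_def)
    let ?F = "{e \<in> Ein. z e = x}"
    \<comment> \<open>A vertical charge at \<open>x\<close> exhibits an empty horizontal neighbour of \<open>x\<close>, which cannot
      itself charge \<open>x\<close>; symmetrically for horizontal charges.\<close>
    have vert: "\<exists>d. (d = j - 1 \<or> d = j + 1) \<and> (i, d) \<notin> A \<and> (k = i - 1 \<or> k = i + 1) \<and> l = j \<and> (k, l) \<in> A"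
      if "((k, l), True) \<in> ?F" for k l
    proof -
      from that have kl: "(k, l) \<in> A" "f (k, l) = i" "l = j"
        by (auto simp: Ein_def E_def z_def x)
      with fg[OF kl(1)] A ij show ?thesis
        by (intro exI[of _ "g (k, l)"]) auto
    qed
    have horiz: "\<exists>c. (c = i - 1 \<or> c = i + 1) \<and> (c, j) \<notin> A \<and> (l = j - 1 \<or> l = j + 1) \<and> k = i \<and> (k, l) \<in> A"
      if "((k, l), False) \<in> ?F" for k l
    proof -
      from that have kl: "(k, l) \<in> A" "g (k, l) = j" "k = i"
        by (auto simp: Ein_def E_def z_def x)
      with fg[OF kl(1)] A ij show ?thesis
        by (intro exI[of _ "f (k, l)"]) auto
    qed
    have "\<exists>s t. ?F \<subseteq> {s, t}"
    proof (cases "\<exists>p. (p, True) \<in> ?F")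
      case False
      then have "?F \<subseteq> {((i, j - 1), False), ((i, j + 1), False)}"
      proof (intro subsetI)
        fix e assume e: "e \<in> ?F"
        obtain k l v where e': "e = ((k, l), v)" by (metis old.prod.exhaust)
        show "e \<in> {((i, j - 1), False), ((i, j + 1), False)}"
        proof (cases v)
          case True
          then show ?thesis using \<open>\<nexists>p. (p, True) \<in> ?F\<close> e unfolding e' by auto
        next
          case False
          then show ?thesis using e horiz[of k l] unfolding e' by auto
        qed
      qed
      then show ?thesis by blast
    next
      case True
      then obtain d where d: "d = j - 1 \<or> d = j + 1" "(i, d) \<notin> A"
        using vert by fast
      show ?thesis
      proof (cases "\<exists>p. (p, False) \<in> ?F")
        case False
        then have "?F \<subseteq> {((i - 1, j), True), ((i + 1, j), True)}"
        proof (intro subsetI)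
          fix e assume e: "e \<in> ?F"
          obtain k l v where e': "e = ((k, l), v)" by (metis old.prod.exhaust)
          show "e \<in> {((i - 1, j), True), ((i + 1, j), True)}"
          proof (cases v)
            case True
            then show ?thesis using e vert[of k l] unfolding e' by auto
          next
            case False
            then show ?thesis using \<open>\<nexists>p. (p, False) \<in> ?F\<close> e unfolding e' by auto
          qed
        qed
        then show ?thesis by blast
      next
        case True
        then obtain c where c: "c = i - 1 \<or> c = i + 1" "(c, j) \<notin> A"
          using horiz by fast
        \<comment> \<open>Both kinds of charges occur, so one vertical and one horizontal neighbour are empty and
          only the neighbours opposite to them can charge.\<close>
        define c' where "c' = (if c = i - 1 then i + 1 else i - 1)"
        define d' where "d' = (if d = j - 1 then j + 1 else j - 1)"
        have "e = ((c', j), True) \<or> e = ((i, d'), False)" if "e \<in> ?F" for e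
        proof -
          obtain k l v where e: "e = ((k, l), v)" by (metis old.prod.exhaust)
          show ?thesis
          proof (cases v)
            case True
            then have "((k, l), True) \<in> ?F" using that e by simp
            from vert[OF this] have kl: "k = i - 1 \<or> k = i + 1" "l = j" "(k, l) \<in> A"
              by blast+
            then have "k \<noteq> c" using c(2) by blast
            then have "k = c'" using kl(1) c(1) by (auto simp: c'_def)
            then show ?thesis using True kl(2) by (simp add: e)
          next
            case False
            then have "((k, l), False) \<in> ?F" using that e by simp
            from horiz[OF this] have kl: "l = j - 1 \<or> l = j + 1" "k = i" "(k, l) \<in> A"
              by blast+
            then have "l \<noteq> d" using d(2) by blast
            then have "l = d'" using kl(1) d(1) by (auto simp: d'_def)
            then show ?thesis using False kl(2) by (simp add: e)
          qed
        qed
        then have "?F \<subseteq> {((c', j), True), ((i, d'), False)}" by blast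
        then show ?thesis by blast
      qed
    qed
    then obtain s t where "?F \<subseteq> {s, t}" by blast
    from card_mono[OF _ this] show "card ?F \<le> 2"
      by (simp add: card_insert_if split: if_splits)
  qed
  moreover have "card Eout + 4 * (n div 3) \<le> 4 * n"
  proof -
    define Row where "Row = (\<lambda>a. {b. (a, b) \<in> A})"
    define Col where "Col = (\<lambda>b. {a. (a, b) \<in> A})"
    \<comment> \<open>The middle one of three consecutive members would have no empty neighbour on its line.\<close>
    have row: "card (Row a) + n div 3 \<le> n" for a
    proof (rule card_no_three_consecutive)
      show "Row a \<subseteq> {1..n}" using A by (auto simp: Row_def)
      show False if "b \<in> Row a" "b + 1 \<in> Row a" "b + 2 \<in> Row a" for b
        using fg[of "(a, b + 1)"] that by (auto simp: Row_def)
    qed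
    have col: "card (Col b) + n div 3 \<le> n" for b
    proof (rule card_no_three_consecutive)
      show "Col b \<subseteq> {1..n}" using A by (auto simp: Col_def)
      show False if "a \<in> Col b" "a + 1 \<in> Col b" "a + 2 \<in> Col b" for a
        using fg[of "(a + 1, b)"] that by (auto simp: Col_def)
    qed
    have "Row a \<subseteq> {1..n}" "Col a \<subseteq> {1..n}" for a
      using A by (auto simp: Row_def Col_def)
    then have fin: "finite (Row a)" "finite (Col a)" for a
      by (meson finite_subset finite_atLeastAtMost)+
    let ?R = "\<lambda>a. (\<lambda>b. ((a, b), True)) ` Row a"
    let ?C = "\<lambda>b. (\<lambda>a. ((a, b), False)) ` Col b"
    have "Eout \<subseteq> (?R 1 \<union> ?R n) \<union> (?C 1 \<union> ?C n)"
    proof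
      fix e assume e: "e \<in> Eout"
      obtain a b v where e': "e = ((a, b), v)" by (metis old.prod.exhaust)
      from e e' have ab: "(a, b) \<in> A" "z e \<notin> X" by (auto simp: Eout_def E_def)
      have bd: "1 \<le> a" "a \<le> n" "1 \<le> b" "b \<le> n" using ab A by auto
      show "e \<in> (?R 1 \<union> ?R n) \<union> (?C 1 \<union> ?C n)"
      proof (cases v)
        case True
        then have "a = 1 \<or> a = n"
          using ab bd fg[OF ab(1)] by (auto simp: z_def X_def e')
        then show ?thesis using True ab by (auto simp: e' Row_def)
      next
        case False
        then have "b = 1 \<or> b = n"
          using ab bd fg[OF ab(1)] by (auto simp: z_def X_def e')
        then show ?thesis using False ab by (auto simp: e' Col_def)
      qed
    qed
    then have "card Eout \<le> card ((?R 1 \<union> ?R n) \<union> (?C 1 \<union> ?C n))"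
      by (rule card_mono[rotated]) (simp add: fin)
    also have "\<dots> \<le> (card (?R 1) + card (?R n)) + (card (?C 1) + card (?C n))"
      by (meson add_mono card_Un_le order_trans)
    also have "\<dots> \<le> (card (Row 1) + card (Row n)) + (card (Col 1) + card (Col n))"
      by (intro add_mono card_image_le fin)
    finally show ?thesis
      using row[of 1] row[of n] col[of 1] col[of n] by linarith
  qed
  moreover have "card E \<le> card Ein + card Eout"
  proof -
    have "Ein \<union> Eout = E" by (auto simp: Ein_def Eout_def)
    then show ?thesis using card_Un_le[of Ein Eout] by (simp only:)
  qed
  ultimately show ?thesis
    using cardE cardX by linarith
qed

lemma irredundant_cover_card_le:
  assumes "irredundant_cover m U"
  shows "2 * card U + 2 * ((m - 1) div 3) \<le> (m - 1)\<^sup>2 + 2 * (m - 1)"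
proof -
  have U: "U \<subseteq> blocks m" and priv: "\<And>C. C \<in> U \<Longrightarrow> \<exists>x. private_square U C x"
    using assms by (auto simp: irredundant_cover_def configuration_def)
  have "2 * card (positions U) + 2 * ((m - 1) div 3) \<le> (m - 1)\<^sup>2 + 2 * (m - 1)"
  proof (rule card_free_corner_le[OF positions_subset[OF U]])
    fix a b assume ab: "(a, b) \<in> positions U"
    then have "block a b \<in> U" "a \<ge> 1" "b \<ge> 1"
      using positions_subset[OF U] by (auto simp: positions_def)
    with priv show "\<exists>c d. (c = a - 1 \<or> c = a + 1) \<and> (d = b - 1 \<or> d = b + 1) \<and>
           (c, b) \<notin> positions U \<and> (a, d) \<notin> positions U \<and> (c, d) \<notin> positions U"
      using private_square_free_corner by blast
  qed
  then show ?thesis by (simp add: card_positions[OF U])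
qed

section \<open>The lower bound\<close>

text \<open>
In a subcover of least cardinality no member can be dropped, so each has a point of its own.
\<close>

lemma minimal_subcover:
  assumes "finite V" and "G \<subseteq> \<Union>V"
  shows "\<exists>U\<subseteq>V. G \<subseteq> \<Union>U \<and> (\<forall>C\<in>U. \<exists>x\<in>C. \<forall>D\<in>U. x \<in> D \<longrightarrow> D = C)"
proof -
  define P where "P = (\<lambda>U. U \<subseteq> V \<and> G \<subseteq> \<Union>U)"
  have "P V" using assms(2) by (simp add: P_def)
  then obtain U where "P U" and P: "\<And>W. P W \<Longrightarrow> card U \<le> card W"
    using ex_has_least_nat[of P V card] by blast
  have U: "U \<subseteq> V" "G \<subseteq> \<Union>U" using \<open>P U\<close> by (simp_all add: P_def)
  have least: "card U \<le> card W" if "W \<subseteq> V" "G \<subseteq> \<Union>W" for W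
    using P[of W] that by (simp add: P_def)
  have "\<exists>x\<in>C. \<forall>D\<in>U. x \<in> D \<longrightarrow> D = C" if C: "C \<in> U" for C
  proof (rule ccontr)
    assume "\<not> ?thesis"
    then have "G \<subseteq> \<Union>(U - {C})" using U(2) by blast
    then have "card U \<le> card (U - {C})" using U(1) by (intro least) auto
    moreover have "finite U" using U(1) assms(1) finite_subset by blast
    ultimately show False using C by (meson card_Diff1_less leD)
  qed
  with U show ?thesis by blast
qed

text \<open>
The tool for finding large irredundant covers without describing them: a cover made of
blocks that meet \<open>S\<close> at most once has at least as many blocks as \<open>S\<close> has squares, and
so does any minimal subcover of it.
\<close>

lemma irredundant_cover_of_spread_set:
  assumes "m \<ge> 1" and S: "S \<subseteq> grid m"
    and cover: "\<And>x. x \<in> grid m \<Longrightarrow>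
      \<exists>C\<in>blocks m. x \<in> C \<and> (\<forall>y\<in>C \<inter> S. \<forall>y'\<in>C \<inter> S. y = y')"
  obtains U where "irredundant_cover m U" "card S \<le> card U"
proof -
  define V where "V = {C \<in> blocks m. \<forall>y\<in>C \<inter> S. \<forall>y'\<in>C \<inter> S. y = y'}"
  have finV: "finite V" using finite_blocks by (simp add: V_def)
  have covV: "grid m \<subseteq> \<Union>V"
  proof
    fix x assume "x \<in> grid m"
    from cover[OF this] show "x \<in> \<Union>V" unfolding V_def by blast
  qed
  obtain U where U: "U \<subseteq> V" "grid m \<subseteq> \<Union>U"
    and priv: "\<forall>C\<in>U. \<exists>x\<in>C. \<forall>D\<in>U. x \<in> D \<longrightarrow> D = C"
    using minimal_subcover[OF finV covV] by (elim exE conjE)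
  have finU: "finite U" using finV U(1) finite_subset by blast
  have "irredundant_cover m U"
    unfolding irredundant_cover_def configuration_def
  proof (intro conjI ballI)
    have "(1, 1) \<in> grid m" using assms(1) by (simp add: grid_def)
    then show "U \<noteq> {}" using U(2) by blast
    show "U \<subseteq> blocks m" using U(1) by (auto simp: V_def)
  next
    fix x assume "x \<in> grid m"
    then have "{C \<in> U. x \<in> C} \<noteq> {}" using U(2) by blast
    then show "square_mult U x \<ge> 1"
      using finU by (simp add: square_mult_def Suc_le_eq card_gt_0_iff)
  next
    fix C assume C: "C \<in> U"
    then obtain x where x: "x \<in> C" "\<forall>D\<in>U. x \<in> D \<longrightarrow> D = C" using priv by blast
    then have "{D \<in> U. x \<in> D} = {C}" using C by blast
    then have "private_square U C x"
      using x(1) by (simp add: private_square_def square_mult_def)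
    then show "\<exists>x. private_square U C x" ..
  qed
  moreover have "card S \<le> card U"
  proof -
    have "\<forall>y\<in>S. \<exists>C\<in>U. y \<in> C" using S U(2) by blast
    then obtain h where h: "\<And>y. y \<in> S \<Longrightarrow> h y \<in> U \<and> y \<in> h y" by metis
    have "inj_on h S"
    proof (rule inj_onI)
      fix y y' assume "y \<in> S" "y' \<in> S" "h y = h y'"
      moreover have "h y \<in> V" using h U(1) \<open>y \<in> S\<close> by blast
      ultimately show "y = y'" using h[of y] h[of y'] by (auto simp: V_def)
    qed
    then show ?thesis using h finU by (intro card_inj_on_le[of h]) auto
  qed
  ultimately show ?thesis using that by blast
qed

text \<open>
Deep inside the grid the private squares may fill two of every four consecutive diagonals.
Along the border this would leave squares that only blocks with several chosen squares
cover; therefore the stripes stop one square before the border.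
\<close>

definition stripes :: "nat \<Rightarrow> square set" where
  "stripes m = {(i, j). 2 \<le> i \<and> i < m \<and> 2 \<le> j \<and> j < m \<and> (i + j) mod 4 \<in> {1, 2}}"

text \<open>
A corner square lies in a single block, so it may be added whenever that block contains no
square of the stripes. As \<open>(2, 2)\<close> lies off the stripes, this is always the case at
\<open>(1, 1)\<close>; at \<open>(m, m)\<close> it holds for odd \<open>m\<close>. In that case the second corner is
wanted, because the stripes may fall half a square short of half the inner squares.
\<close>

definition spread :: "nat \<Rightarrow> square set" where
  "spread m = stripes m \<union> insert (1, 1) (if odd m then {(m, m)} else {})"

text \<open>
Count rows and columns of the inner board from 0; this lowers \<open>i + j\<close> by 4 and keeps the
residue. Give a square weight \<open>e (i + j)\<close>, which is 1 on the stripes and -1 off them; the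
total weight of the inner board is twice the number of stripe squares minus the area. Summing by
antidifferences (\<open>q\<close> of \<open>e\<close>, \<open>p\<close> of \<open>q\<close>) evaluates the double sum as
\<open>p (2 n) - 2 p n\<close>. Both antidifferences have period 4, so the total depends only on
\<open>n mod 4\<close>.
\<close>

lemma card_stripes:
  "2 * int (card (stripes (n + 2))) \<ge> int n ^ 2 - int (n mod 2)"
proof -
  define e :: "nat \<Rightarrow> int" where "e = (\<lambda>t. if t mod 4 \<in> {1, 2} then 1 else - 1)"
  define q :: "nat \<Rightarrow> int" where
    "q = (\<lambda>t. if t mod 4 = 1 then - 1 else if t mod 4 = 3 then 1 else 0)"
  define p :: "nat \<Rightarrow> int" where "p = (\<lambda>t. if t mod 4 \<in> {2, 3} then - 1 else 0)"
  have m4: "t mod 4 = 0 \<or> t mod 4 = 1 \<or> t mod 4 = 2 \<or> t mod 4 = 3" for t :: nat by presburger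
  have qS: "q (Suc t) = q t + e t" for t
    using m4[of t] by (auto simp: q_def e_def mod_Suc)
  have pS: "p (Suc t) = p t + q t" for t
    using m4[of t] by (auto simp: p_def q_def mod_Suc)
  have p0: "p 0 = 0" by (simp add: p_def)
  have row: "(\<Sum>j<n. e (i + j)) = q (i + n) - q i" for i n
    by (induction n) (auto simp: qS)
  have sq: "(\<Sum>i<k. q (i + n)) = p (k + n) - p n" for n k
    by (induction k) (auto simp: pS)
  have "(\<Sum>i<n. \<Sum>j<n. e (i + j)) = (\<Sum>i<n. q (i + n)) - (\<Sum>i<n. q (i + 0))"
    by (simp add: row sum_subtractf)
  also have "\<dots> = p (2 * n) - 2 * p n"
    using sq[where n = n and k = n] sq[where n = 0 and k = n] p0 unfolding mult_2 add_0_right by linarith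
  also have "\<dots> \<ge> - int (n mod 2)"
  proof -
    have "n mod 4 = 0 \<and> 2 * n mod 4 = 0 \<and> n mod 2 = 0 \<or> n mod 4 = 1 \<and> 2 * n mod 4 = 2 \<and> n mod 2 = 1 \<or>
          n mod 4 = 2 \<and> 2 * n mod 4 = 0 \<and> n mod 2 = 0 \<or> n mod 4 = 3 \<and> 2 * n mod 4 = 2 \<and> n mod 2 = 1"
      by presburger
    then show ?thesis by (elim disjE) (auto simp: p_def)
  qed
  finally have lower: "(\<Sum>i<n. \<Sum>j<n. e (i + j)) \<ge> - int (n mod 2)" .
  let ?Q = "{..<n} \<times> {..<n}"
  let ?T = "{(i, j) \<in> ?Q. (i + j) mod 4 \<in> {1, 2}}"
  have e_eq: "e t = 2 * (if t mod 4 \<in> {1, 2} then 1 else 0) - 1" for t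
    by (simp add: e_def)
  have "(\<Sum>i<n. \<Sum>j<n. e (i + j)) = (\<Sum>x\<in>?Q. e (fst x + snd x))"
    by (simp add: sum.cartesian_product case_prod_beta)
  also have "\<dots> = 2 * (\<Sum>x\<in>?Q. if (fst x + snd x) mod 4 \<in> {1, 2} then 1 else 0) - int n ^ 2"
    unfolding e_eq sum_subtractf sum_distrib_left[symmetric]
    by (simp add: card_cartesian_product power2_eq_square)
  also have "(\<Sum>x\<in>?Q. if (fst x + snd x) mod 4 \<in> {1, 2} then 1 else 0) = int (card ?T)"
  proof -
    have "?T = ?Q \<inter> {x. (fst x + snd x) mod 4 \<in> {1, 2}}" by auto
    then show ?thesis by (simp add: sum.If_cases del: insert_iff)
  qed
  also have "card ?T = card (stripes (n + 2))"
  proof (rule bij_betw_same_card[of "\<lambda>(i, j). (i + 2, j + 2)"])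
    have mod: "(i + 2 + (j + 2)) mod 4 = (i + j) mod 4" for i j :: nat by presburger
    show "bij_betw (\<lambda>(i, j). (i + 2, j + 2)) ?T (stripes (n + 2))"
    proof (rule bij_betw_byWitness[where f' = "\<lambda>(i, j). (i - 2, j - 2)"])
      show "(\<lambda>(i, j). (i + 2, j + 2)) ` ?T \<subseteq> stripes (n + 2)"
        unfolding stripes_def by (auto simp: mod simp del: add_2_eq_Suc')
      show "(\<lambda>(i, j). (i - 2, j - 2)) ` stripes (n + 2) \<subseteq> ?T"
      proof (intro image_subsetI)
        fix x assume "x \<in> stripes (n + 2)"
        moreover obtain i j where "x = (i, j)" by fastforce
        ultimately show "(\<lambda>(i, j). (i - 2, j - 2)) x \<in> ?T"
          using mod[of "i - 2" "j - 2"] by (auto simp: stripes_def)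
      qed
    qed (auto simp: stripes_def)
  qed
  finally show ?thesis using lower by linarith
qed

lemma stripes_finite: "finite (stripes m)"
  by (rule finite_subset[of _ "{..<m} \<times> {..<m}"]) (auto simp: stripes_def)

lemma card_spread:
  assumes "m \<ge> 2"
  shows "2 * real (card (spread m)) \<ge> (real m)\<^sup>2 - 4 * real m + 6"
proof -
  obtain n where n: "m = n + 2" using assms by (metis le_add_diff_inverse2)
  have "card (spread m) = card (stripes m) + (if odd m then 2 else 1)"
  proof -
    have "stripes m \<inter> insert (1, 1) (if odd m then {(m, m)} else {}) = {}"
      by (auto simp: stripes_def)
    then have "card (spread m) = card (stripes m) + card (insert (1, 1) (if odd m then {(m, m)} else {}))"
      unfolding spread_def by (intro card_Un_disjoint) (auto simp: stripes_finite)
    then show ?thesis using assms by auto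
  qed
  then have "2 * int (card (spread m)) \<ge> int n ^ 2 + 2"
    using card_stripes[of n] by (auto simp: n split: if_splits)
  then have "2 * real (card (spread m)) \<ge> real n ^ 2 + 2"
    by (metis (mono_tags, lifting) of_int_add of_int_le_iff of_int_mult of_int_numeral of_int_of_nat_eq of_int_power)
  then show ?thesis by (simp add: n power2_eq_square algebra_simps)
qed

lemma spread_subset_grid: "m \<ge> 1 \<Longrightarrow> spread m \<subseteq> grid m"
  by (auto simp: spread_def stripes_def grid_def)

definition sparse :: "nat \<Rightarrow> nat \<Rightarrow> nat \<Rightarrow> bool" where
  "sparse m a b \<longleftrightarrow> (\<forall>y\<in>block a b \<inter> spread m. \<forall>y'\<in>block a b \<inter> spread m. y = y')"

lemma in_spread_iff:
  "(i, j) \<in> spread m \<longleftrightarrow>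
     2 \<le> i \<and> i < m \<and> 2 \<le> j \<and> j < m \<and> ((i + j) mod 4 = 1 \<or> (i + j) mod 4 = 2) \<or>
     i = 1 \<and> j = 1 \<or> odd m \<and> i = m \<and> j = m"
  by (auto simp: spread_def stripes_def)

lemma sparseI:
  assumes "\<not> ((a, b) \<in> spread m \<and> (a + 1, b) \<in> spread m)"
    "\<not> ((a, b) \<in> spread m \<and> (a, b + 1) \<in> spread m)"
    "\<not> ((a, b) \<in> spread m \<and> (a + 1, b + 1) \<in> spread m)"
    "\<not> ((a + 1, b) \<in> spread m \<and> (a, b + 1) \<in> spread m)"
    "\<not> ((a + 1, b) \<in> spread m \<and> (a + 1, b + 1) \<in> spread m)"
    "\<not> ((a, b + 1) \<in> spread m \<and> (a + 1, b + 1) \<in> spread m)"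
  shows "sparse m a b"
  using assms unfolding sparse_def block_def by blast

lemma sparse_commute: "sparse m a b \<Longrightarrow> sparse m b a"
proof -
  have sym: "(i, j) \<in> spread m \<longleftrightarrow> (j, i) \<in> spread m" for i j
    by (auto simp: in_spread_iff add.commute)
  have bsym: "(i, j) \<in> block b a \<longleftrightarrow> (j, i) \<in> block a b" for i j
    by (auto simp: block_def)
  assume sp: "sparse m a b"
  show ?thesis
    unfolding sparse_def
  proof (intro ballI)
    fix y y' assume yy: "y \<in> block b a \<inter> spread m" "y' \<in> block b a \<inter> spread m"
    obtain i j k l where ij: "y = (i, j)" "y' = (k, l)" by (metis old.prod.exhaust)
    have "(j, i) \<in> block a b \<inter> spread m" "(l, k) \<in> block a b \<inter> spread m"
      using yy bsym sym unfolding ij by blast+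
    then have "(j, i) = (l, k)" using sp unfolding sparse_def by blast
    then show "y = y'" by (simp add: ij)
  qed
qed

lemma spread_diagonal:
  assumes "(i, j) \<in> spread m"
  shows "(i + j) mod 4 = 1 \<or> (i + j) mod 4 = 2"
proof -
  have "(m + m) mod 4 = 2" if "odd m" using that by presburger
  then show ?thesis using assms by (auto simp: in_spread_iff)
qed

text \<open>
The diagonals met by the block at \<open>(a, b)\<close> are \<open>a + b\<close>, \<open>a + b + 1\<close> (twice) and
\<open>a + b + 2\<close>. Under the hypothesis the repeated one misses the stripes and at most one of the
other two belongs to them. The added corners do no harm, since they also lie on diagonals
congruent to 1 or 2.
\<close>

lemma sparse_interior:
  assumes "(a + b) mod 4 = 2 \<or> (a + b) mod 4 = 3"
  shows "sparse m a b"
proof -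
  have "(a + 1, b) \<notin> spread m"
  proof
    assume "(a + 1, b) \<in> spread m"
    from spread_diagonal[OF this] assms show False by presburger
  qed
  moreover have "(a, b + 1) \<notin> spread m"
  proof
    assume "(a, b + 1) \<in> spread m"
    from spread_diagonal[OF this] assms show False by presburger
  qed
  moreover have "\<not> ((a, b) \<in> spread m \<and> (a + 1, b + 1) \<in> spread m)"
  proof
    assume both: "(a, b) \<in> spread m \<and> (a + 1, b + 1) \<in> spread m"
    from spread_diagonal[OF conjunct1[OF both]] spread_diagonal[OF conjunct2[OF both]] assms
    show False by presburger
  qed
  ultimately show ?thesis by (intro sparseI) blast+
qed

lemma spread_border:
  assumes "m \<ge> 3"
  shows "(1, l) \<in> spread m \<longleftrightarrow> l = 1"
    and "(m, l) \<in> spread m \<longleftrightarrow> l = m \<and> odd m"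
    and "(2, l) \<in> spread m \<longleftrightarrow> 2 \<le> l \<and> l < m \<and> ((2 + l) mod 4 = 1 \<or> (2 + l) mod 4 = 2)"
    and "(m - 1, l) \<in> spread m \<longleftrightarrow>
           2 \<le> l \<and> l < m \<and> ((m - 1 + l) mod 4 = 1 \<or> (m - 1 + l) mod 4 = 2)"
proof -
  have "m \<noteq> 1" "2 < m" "2 \<le> m - 1" "m - 1 < m" "m - 1 \<noteq> 1" "m - 1 \<noteq> m"
    using assms by auto
  then show "(1, l) \<in> spread m \<longleftrightarrow> l = 1"
    "(m, l) \<in> spread m \<longleftrightarrow> l = m \<and> odd m"
    "(2, l) \<in> spread m \<longleftrightarrow> 2 \<le> l \<and> l < m \<and> ((2 + l) mod 4 = 1 \<or> (2 + l) mod 4 = 2)"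
    "(m - 1, l) \<in> spread m \<longleftrightarrow>
           2 \<le> l \<and> l < m \<and> ((m - 1 + l) mod 4 = 1 \<or> (m - 1 + l) mod 4 = 2)"
    unfolding in_spread_iff by (auto simp del: One_nat_def)
qed

text \<open>
The block at \<open>(1, b)\<close> meets the stripes only in row 2, in two adjacent squares; both are
chosen only if \<open>b \<equiv> 3 (mod 4)\<close>. For \<open>b = 1\<close> and \<open>b = m - 1\<close> one of the two squares
lies in a border column, outside the stripes. The block at \<open>(1, 1)\<close> also contains the
chosen corner, but no stripe square, since \<open>(2, 2)\<close> is off the stripes. The last row is
treated in the same way.
\<close>

lemma sparse_first_row:
  assumes m: "m \<ge> 3" and b: "b mod 4 \<noteq> 3 \<or> b = 1 \<or> b = m - 1" "b \<ge> 1"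
  shows "sparse m 1 b"
proof -
  have two: "\<not> ((2, b) \<in> spread m \<and> (2, b + 1) \<in> spread m)"
    unfolding spread_border[OF m] using b m by presburger
  have "(1, b + 1) \<notin> spread m"
    unfolding spread_border[OF m] using b by simp
  moreover have "(2, b) \<notin> spread m \<and> (2, b + 1) \<notin> spread m" if "(1, b) \<in> spread m"
    using that unfolding spread_border[OF m] by simp
  ultimately show ?thesis
    by (intro sparseI[of 1 b m, unfolded one_add_one]) (use two in blast)+
qed

lemma sparse_last_row:
  assumes m: "m \<ge> 3" and b: "(m - 1 + b) mod 4 \<noteq> 1 \<or> b = 1 \<or> b = m - 1" "b < m"
  shows "sparse m (m - 1) b"
proof -
  have m1: "m - 1 + 1 = m" using m by simp
  have two: "\<not> ((m - 1, b) \<in> spread m \<and> (m - 1, b + 1) \<in> spread m)"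
  proof
    assume "(m - 1, b) \<in> spread m \<and> (m - 1, b + 1) \<in> spread m"
    then have "2 \<le> b" "b + 1 < m"
      "(m - 1 + b) mod 4 = 1 \<or> (m - 1 + b) mod 4 = 2"
      "(m - 1 + (b + 1)) mod 4 = 1 \<or> (m - 1 + (b + 1)) mod 4 = 2"
      unfolding spread_border[OF m] by blast+
    moreover have "s mod 4 = 1"
      if "s mod 4 = 1 \<or> s mod 4 = 2" "(s + 1) mod 4 = 1 \<or> (s + 1) mod 4 = 2" for s :: nat
      using that by presburger
    ultimately have "(m - 1 + b) mod 4 = 1" by (metis add.assoc)
    with \<open>2 \<le> b\<close> \<open>b + 1 < m\<close> b(1) show False by auto
  qed
  have "(m, b) \<notin> spread m"
    unfolding spread_border[OF m] using b by simp
  moreover have "(m - 1, b) \<notin> spread m \<and> (m - 1, b + 1) \<notin> spread m" if "(m, b + 1) \<in> spread m"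
  proof -
    have bm: "b + 1 = m" "odd m" using that unfolding spread_border[OF m] by auto
    then have "m - 1 = b" "even b" by auto
    moreover have "(b + b) mod 4 = 0" using \<open>even b\<close> by presburger
    ultimately show ?thesis unfolding spread_border[OF m] using bm(1) by simp
  qed
  ultimately show ?thesis
    by (intro sparseI[of "m - 1" b m, unfolded m1]) (use two in blast)+
qed

text \<open>
A border square off the corners lies in two blocks along the border, and at most one of
them is not sparse, since the bad positions are four apart. An inner square lies in blocks
starting on three consecutive diagonals, one of which is good for \<open>sparse_interior\<close>.
The blocks in the corners are always sparse.
\<close>

lemma sparse_blocks_cover:
  assumes m: "m \<ge> 3" and x: "(i, j) \<in> grid m"
  obtains a b where "1 \<le> a" "a \<le> m - 1" "1 \<le> b" "b \<le> m - 1" "(i, j) \<in> block a b" "sparse m a b"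
proof -
  have ij: "1 \<le> i" "i \<le> m" "1 \<le> j" "j \<le> m" using x by (auto simp: grid_def)
  have first: "\<exists>b. 1 \<le> b \<and> b \<le> m - 1 \<and> (l = b \<or> l = b + 1) \<and> sparse m 1 b"
    if l: "1 \<le> l" "l \<le> m" for l
  proof -
    consider "l = m" | "l \<noteq> m" "l mod 4 = 3" | "l \<noteq> m" "l mod 4 \<noteq> 3" by blast
    then show ?thesis
    proof cases
      case 1
      then have "sparse m 1 (m - 1)" using m by (intro sparse_first_row) auto
      with 1 m show ?thesis by (intro exI[of _ "m - 1"]) auto
    next
      case 2
      have "s mod 4 \<noteq> 3" if "(s + 1) mod 4 = 3" for s :: nat using that by presburger
      moreover have "l - 1 + 1 = l" using l by simp
      ultimately have "(l - 1) mod 4 \<noteq> 3" using 2(2) by metis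
      moreover have "l \<ge> 2" using l(1) 2(2) by (cases "l = 1") simp_all
      ultimately have "sparse m 1 (l - 1)"
        using sparse_first_row[OF m, of "l - 1"] by linarith
      with \<open>l \<ge> 2\<close> l show ?thesis by (intro exI[of _ "l - 1"]) auto
    next
      case 3
      then have "sparse m 1 l" using sparse_first_row[OF m, of l] l by blast
      with 3 l show ?thesis by (intro exI[of _ l]) auto
    qed
  qed
  have last: "\<exists>b. 1 \<le> b \<and> b \<le> m - 1 \<and> (l = b \<or> l = b + 1) \<and> sparse m (m - 1) b"
    if l: "1 \<le> l" "l \<le> m" for l
  proof -
    consider "l = m" | "l \<noteq> m" "l \<noteq> 1" "(m - 1 + l) mod 4 = 1"
      | "l \<noteq> m" "(m - 1 + l) mod 4 \<noteq> 1 \<or> l = 1" by blast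
    then show ?thesis
    proof cases
      case 1
      then have "sparse m (m - 1) (m - 1)" using m by (intro sparse_last_row) auto
      with 1 m show ?thesis by (intro exI[of _ "m - 1"]) auto
    next
      case 2
      have "s mod 4 \<noteq> 1" if "(s + 1) mod 4 = 1" for s :: nat using that by presburger
      moreover have "m - 1 + (l - 1) + 1 = m - 1 + l" using l by simp
      ultimately have "(m - 1 + (l - 1)) mod 4 \<noteq> 1" using 2(3) by metis
      then have "sparse m (m - 1) (l - 1)" using sparse_last_row[OF m, of "l - 1"] l by linarith
      with 2 l show ?thesis by (intro exI[of _ "l - 1"]) auto
    next
      case 3
      then have "sparse m (m - 1) l" using sparse_last_row[OF m, of l] l by linarith
      with 3 l show ?thesis by (intro exI[of _ l]) auto
    qed
  qed
  consider "i = 1" | "i = m" | "j = 1" | "j = m" | "2 \<le> i" "i \<le> m - 1" "2 \<le> j" "j \<le> m - 1"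
    using ij by linarith
  then show thesis
  proof cases
    case 1
    obtain b where "1 \<le> b" "b \<le> m - 1" "j = b \<or> j = b + 1" "sparse m 1 b"
      using first ij by blast
    with 1 m show thesis by (intro that[of 1 b]) (auto simp: block_def)
  next
    case 2
    obtain b where "1 \<le> b" "b \<le> m - 1" "j = b \<or> j = b + 1" "sparse m (m - 1) b"
      using last ij by blast
    with 2 m show thesis by (intro that[of "m - 1" b]) (auto simp: block_def)
  next
    case 3
    obtain b where "1 \<le> b" "b \<le> m - 1" "i = b \<or> i = b + 1" "sparse m 1 b"
      using first ij by blast
    moreover from this(4) have "sparse m b 1" by (rule sparse_commute)
    ultimately show thesis using 3 m by (intro that[of b 1]) (auto simp: block_def)
  next
    case 4
    obtain b where "1 \<le> b" "b \<le> m - 1" "i = b \<or> i = b + 1" "sparse m (m - 1) b"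
      using last ij by blast
    moreover from this(4) have "sparse m b (m - 1)" by (rule sparse_commute)
    ultimately show thesis using 4 m by (intro that[of b "m - 1"]) (auto simp: block_def)
  next
    case 5
    obtain k l where kl: "i = k + 1" "j = l + 1"
      using 5 by (metis add.commute le_Suc_ex one_add_one add.assoc)
    have "(s + 2) mod 4 = 2 \<or> (s + 2) mod 4 = 3 \<or> (s + 1) mod 4 = 3 \<or> s mod 4 = 3" for s :: nat
      by presburger
    from this[of "k + l"] consider "sparse m i j" | "sparse m k j" | "sparse m k l"
      using sparse_interior[of i j m] sparse_interior[of k j m] sparse_interior[of k l m]
      unfolding kl by (auto simp: add.assoc add.commute add.left_commute)
    then show thesis
    proof cases
      case 1
      with 5 show thesis by (intro that[of i j]) (auto simp: block_def)
    next
      case 2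
      with 5 kl show thesis by (intro that[of k j]) (auto simp: block_def)
    next
      case 3
      with 5 kl show thesis by (intro that[of k l]) (auto simp: block_def)
    qed
  qed
qed

lemma ex_large_irredundant_cover:
  assumes "m \<ge> 3"
  obtains U where "irredundant_cover m U" "2 * real (card U) \<ge> (real m)\<^sup>2 - 4 * real m + 6"
proof -
  obtain U where U: "irredundant_cover m U" "card (spread m) \<le> card U"
  proof (rule irredundant_cover_of_spread_set[of m "spread m"])
    show "m \<ge> 1" "spread m \<subseteq> grid m" using assms spread_subset_grid[of m] by auto
    fix x assume x: "x \<in> grid m"
    obtain i j where ij: "x = (i, j)" by fastforce
    obtain a b where ab: "1 \<le> a" "a \<le> m - 1" "1 \<le> b" "b \<le> m - 1" "(i, j) \<in> block a b" "sparse m a b"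
      using sparse_blocks_cover[OF assms x[unfolded ij]] .
    then have "block a b \<in> blocks m" by (auto simp: blocks_def)
    with ab show "\<exists>C\<in>blocks m. x \<in> C \<and> (\<forall>y\<in>C \<inter> spread m. \<forall>y'\<in>C \<inter> spread m. y = y')"
      unfolding sparse_def ij by blast
  qed
  have "2 * real (card U) \<ge> (real m)\<^sup>2 - 4 * real m + 6"
    using card_spread[of m] U(2) assms by linarith
  with U(1) show ?thesis by (rule that)
qed

section \<open>The maximum\<close>

lemma finite_irredundant_cards: "finite {card U | U. irredundant_cover m U}"
proof (rule finite_subset)
  show "{card U | U. irredundant_cover m U} \<subseteq> card ` Pow (blocks m)"
    by (auto simp: irredundant_cover_def configuration_def)
qed (simp add: finite_blocks)

lemma max_irredundant_bounds:
  assumes "m \<ge> 6"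
  shows "2 * real m / 9 \<le> 1 / 2 * (real m)\<^sup>2 - real (max_irredundant m)"
    and "1 / 2 * (real m)\<^sup>2 - real (max_irredundant m) \<le> 2 * real m - 3"
proof -
  obtain W where W: "irredundant_cover m W" "2 * real (card W) \<ge> (real m)\<^sup>2 - 4 * real m + 6"
    using ex_large_irredundant_cover[of m] assms by auto
  have "card W \<le> max_irredundant m"
    unfolding max_irredundant_def using W(1) finite_irredundant_cards by (intro Max_ge) auto
  with W(2) show "1 / 2 * (real m)\<^sup>2 - real (max_irredundant m) \<le> 2 * real m - 3"
    by linarith
  have "max_irredundant m \<in> {card U | U. irredundant_cover m U}"
    unfolding max_irredundant_def using W(1) finite_irredundant_cards by (intro Max_in) auto
  then obtain U where U: "irredundant_cover m U" "max_irredundant m = card U" by auto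
  define n where "n = m - 1"
  have m: "m = n + 1" using assms by (simp add: n_def)
  have "2 * card U + 2 * (n div 3) \<le> n\<^sup>2 + 2 * n"
    using irredundant_cover_card_le[OF U(1)] by (simp add: n_def)
  then have "real (2 * card U + 2 * (n div 3)) \<le> real (n\<^sup>2 + 2 * n)"
    by (rule of_nat_mono)
  then have "2 * real (card U) + 2 * real (n div 3) \<le> (real m)\<^sup>2 - 1"
    by (simp add: m power2_eq_square algebra_simps)
  moreover have "3 * real (n div 3) \<ge> real m - 3"
  proof -
    have "3 * (n div 3) + 3 \<ge> m" using m by linarith
    then have "real (3 * (n div 3) + 3) \<ge> real m" by (rule of_nat_mono)
    then show ?thesis by simp
  qed
  moreover have "real m \<ge> 6" using assms by simp
  ultimately show "2 * real m / 9 \<le> 1 / 2 * (real m)\<^sup>2 - real (max_irredundant m)"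
    unfolding U(2) by linarith
qed

theorem mainTheorem1:
  shows "(\<forall>m::nat. m \<ge> 6 \<longrightarrow>
            2 * real m / 9 \<le> 1 / 2 * (real m)\<^sup>2 - real (max_irredundant m) \<and>
            1 / 2 * (real m)\<^sup>2 - real (max_irredundant m) \<le> 2 * real m - 3) \<and>
         (\<exists>c c' :: real. c > 0 \<and> c' > 0 \<and>
            (\<forall>\<^sub>F m in sequentially.
               c * real m \<le> 1 / 2 * (real m)\<^sup>2 - real (max_irredundant m) \<and>
               1 / 2 * (real m)\<^sup>2 - real (max_irredundant m) \<le> c' * real m)) \<and>
         ((\<lambda>m. real (max_irredundant m) / (real m)\<^sup>2) \<longlonglongrightarrow> 1 / 2)"
proof (intro conjI)
  show "\<forall>m::nat. m \<ge> 6 \<longrightarrow>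
            2 * real m / 9 \<le> 1 / 2 * (real m)\<^sup>2 - real (max_irredundant m) \<and>
            1 / 2 * (real m)\<^sup>2 - real (max_irredundant m) \<le> 2 * real m - 3"
    using max_irredundant_bounds by blast
  have lin: "2 / 9 * real m \<le> 1 / 2 * (real m)\<^sup>2 - real (max_irredundant m) \<and>
      1 / 2 * (real m)\<^sup>2 - real (max_irredundant m) \<le> 2 * real m" if "m \<ge> 6" for m
    using max_irredundant_bounds[OF that] by simp
  have ev: "\<forall>\<^sub>F m in sequentially. 2 / 9 * real m \<le> 1 / 2 * (real m)\<^sup>2 - real (max_irredundant m) \<and>
      1 / 2 * (real m)\<^sup>2 - real (max_irredundant m) \<le> 2 * real m"
    using lin by (rule eventually_sequentiallyI)
  then show "\<exists>c c' :: real. c > 0 \<and> c' > 0 \<and>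
            (\<forall>\<^sub>F m in sequentially.
               c * real m \<le> 1 / 2 * (real m)\<^sup>2 - real (max_irredundant m) \<and>
               1 / 2 * (real m)\<^sup>2 - real (max_irredundant m) \<le> c' * real m)"
    by (intro exI[of _ "2 / 9"] exI[of _ 2] conjI) simp_all
  have sq: "1 / 2 - 2 / real m \<le> real (max_irredundant m) / (real m)\<^sup>2 \<and>
      real (max_irredundant m) / (real m)\<^sup>2 \<le> 1 / 2" if "m \<ge> 6" for m
  proof -
    have pos: "real m > 0" using that by simp
    have "1 / 2 - 2 / real m = (1 / 2 * (real m)\<^sup>2 - 2 * real m) / (real m)\<^sup>2"
      using pos by (simp add: field_simps power2_eq_square)
    also have "\<dots> \<le> real (max_irredundant m) / (real m)\<^sup>2"
      using lin[OF that] by (intro divide_right_mono) auto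
    finally have "1 / 2 - 2 / real m \<le> real (max_irredundant m) / (real m)\<^sup>2" .
    moreover have "real (max_irredundant m) \<le> 1 / 2 * (real m)\<^sup>2"
      using lin[OF that] pos by linarith
    then have "real (max_irredundant m) / (real m)\<^sup>2 \<le> 1 / 2"
      using pos by (simp add: divide_le_eq)
    ultimately show ?thesis by blast
  qed
  show "(\<lambda>m. real (max_irredundant m) / (real m)\<^sup>2) \<longlonglongrightarrow> 1 / 2"
  proof (rule tendsto_sandwich)
    show "\<forall>\<^sub>F m in sequentially. 1 / 2 - 2 / real m \<le> real (max_irredundant m) / (real m)\<^sup>2"
      "\<forall>\<^sub>F m in sequentially. real (max_irredundant m) / (real m)\<^sup>2 \<le> 1 / 2"
      using sq by (auto intro: eventually_sequentiallyI[of 6])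
    have "(\<lambda>m. 1 / 2 - 2 / real m) \<longlonglongrightarrow> 1 / 2 - 0"
      by (intro tendsto_diff tendsto_const lim_const_over_n)
    then show "(\<lambda>m. 1 / 2 - 2 / real m) \<longlonglongrightarrow> 1 / 2" by simp
  qed simp
qed

end
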